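(* Let $(X,d)$ be a nonempty metric space and let $S,T,f,g: X\to X$ be mappings such that $SX\subset fX$, $TX\subset fX$ and $fX=gX$. Let $\alpha,\beta,\gamma,\delta\in[0,1)$ satisfy $\alpha+\beta+\gamma+2\delta<1$ and let $L\ge 0$. Assume that for all $x,y\in X$ $$d(Sx,Ty)\le \alpha\, d(fx,Sx)+\beta\, d(gy,Ty)+\gamma\, d(fx,gy)+\delta\,[d(gy,Sx)+d(fx,Ty)]+L\min\{d(fx,Sx),\,d(gy,Ty),\,d(gy,Sx),\,d(fx,Ty)\}.$$ If $(S,f)$ and $(T,g)$ are weakly compatible and $fX$ is a complete subspace of $X$, then $S$, $T$, $f$ and $g$ have a unique common fixed point in $X$, i.e. there is exactly one $z\in X$ with $Sz=Tz=fz=gz=z$.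
   Context: For a mapping $h:X\to X$, $hX$ denotes the image $\{hx : x\in X\}$; $\subset$ allows equality; a subset of $X$ is a complete subspace if it is complete in the metric induced by $d$. Two mappings $T,f:X\to X$ are weakly compatible if they commute at their coincidence points, i.e. $Tfx=fTx$ for every $x\in X$ with $Tx=fx$. *)

theory Defs
  imports "HOL-Analysis.Analysis"
begin

definition weakly_compatible :: "('a \<Rightarrow> 'a) \<Rightarrow> ('a \<Rightarrow> 'a) \<Rightarrow> bool" where
  "weakly_compatible T f \<longleftrightarrow> (\<forall>x. T x = f x \<longrightarrow> T (f x) = f (T x))"

end

theory Submission
  imports Defs
begin

text \<open>
  Write \<open>C\<close> for the common range of \<open>f\<close> and \<open>g\<close> and choose right inverses of both maps on \<open>C\<close>.
  Composing them with \<open>S\<close> and \<open>T\<close> gives self-maps \<open>F\<close> and \<open>G\<close> of the complete set \<open>C\<close> that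
  satisfy the same inequality with \<open>f\<close> and \<open>g\<close> replaced by the identity. A fixed point of \<open>F\<close>
  is a coincidence value of \<open>S\<close> and \<open>f\<close>, and likewise for \<open>G\<close>, \<open>T\<close> and \<open>g\<close>.

  The orbit that applies \<open>F\<close> and \<open>G\<close> alternately has geometrically decreasing steps: between
  two consecutive steps one of the cross distances is zero, so the term with \<open>L\<close> disappears,
  and \<open>\<alpha> + \<beta> + \<gamma> + 2 * \<delta> < 1\<close> bounds the ratio below one (\<open>alternate_step\<close>,
  \<open>alternating_orbit_Cauchy\<close>). The limit of the orbit is fixed by both maps
  (\<open>common_fixed_point\<close>).

  On the other hand, the inequality forces every coincidence value of \<open>(S, f)\<close> to equal every
  coincidence value of \<open>(T, g)\<close> (\<open>coincidence_values_agree\<close>). Weak compatibility turns the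
  coincidence value \<open>u\<close> just found into a coincidence point of both pairs, so \<open>S u\<close> and
  \<open>T u\<close> are again coincidence values and must both equal \<open>u\<close>. Uniqueness is the same
  principle applied to two common fixed points.
\<close>

text \<open>
  The maps \<open>f\<close> and \<open>g\<close> and the domain \<open>A\<close> are parameters so that the hypothesis on
  \<open>S, T, f, g\<close> and its reduction to two self-maps of the common range, where \<open>f\<close> and \<open>g\<close>
  become the identity, are instances of one notion.
\<close>

definition almost_contractive ::
  "real \<Rightarrow> real \<Rightarrow> real \<Rightarrow> real \<Rightarrow> real \<Rightarrow> 'b set \<Rightarrow> ('b \<Rightarrow> 'a::metric_space) \<Rightarrow> ('b \<Rightarrow> 'a)
    \<Rightarrow> ('b \<Rightarrow> 'a) \<Rightarrow> ('b \<Rightarrow> 'a) \<Rightarrow> bool" where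
  "almost_contractive \<alpha> \<beta> \<gamma> \<delta> L A f g S T \<longleftrightarrow>
    0 \<le> \<alpha> \<and> 0 \<le> \<beta> \<and> 0 \<le> \<gamma> \<and> 0 \<le> \<delta> \<and> \<alpha> + \<beta> + \<gamma> + 2 * \<delta> < 1 \<and> 0 \<le> L \<and>
    (\<forall>x\<in>A. \<forall>y\<in>A. dist (S x) (T y) \<le>
       \<alpha> * dist (f x) (S x) + \<beta> * dist (g y) (T y) + \<gamma> * dist (f x) (g y)
       + \<delta> * (dist (g y) (S x) + dist (f x) (T y))
       + L * Min {dist (f x) (S x), dist (g y) (T y), dist (g y) (S x), dist (f x) (T y)})"

text \<open>
  In every application one of the four distances is zero or tends to zero, and the minimum
  is estimated by that one.
\<close>

lemma almost_contractive_bound: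
  assumes "almost_contractive \<alpha> \<beta> \<gamma> \<delta> L A f g S T" and "x \<in> A" and "y \<in> A"
    and "m \<in> {dist (f x) (S x), dist (g y) (T y), dist (g y) (S x), dist (f x) (T y)}"
  shows "dist (S x) (T y) \<le>
      \<alpha> * dist (f x) (S x) + \<beta> * dist (g y) (T y) + \<gamma> * dist (f x) (g y)
      + \<delta> * (dist (g y) (S x) + dist (f x) (T y)) + L * m"
proof -
  let ?D = "{dist (f x) (S x), dist (g y) (T y), dist (g y) (S x), dist (f x) (T y)}"
  have "Min ?D \<le> m"
    using assms(4) by (intro Min_le) simp_all
  then have "L * Min ?D \<le> L * m"
    using assms(1) by (intro mult_left_mono) (simp_all add: almost_contractive_def)
  moreover have "dist (S x) (T y) \<le>
      \<alpha> * dist (f x) (S x) + \<beta> * dist (g y) (T y) + \<gamma> * dist (f x) (g y)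
      + \<delta> * (dist (g y) (S x) + dist (f x) (T y)) + L * Min ?D"
    using assms(1-3) by (simp add: almost_contractive_def)
  ultimately show ?thesis by linarith
qed

lemma almost_contractive_swap:
  assumes "almost_contractive \<alpha> \<beta> \<gamma> \<delta> L A f g S T"
  shows "almost_contractive \<beta> \<alpha> \<gamma> \<delta> L A g f T S"
proof -
  have "dist (T x) (S y) \<le>
      \<beta> * dist (g x) (T x) + \<alpha> * dist (f y) (S y) + \<gamma> * dist (g x) (f y)
      + \<delta> * (dist (f y) (T x) + dist (g x) (S y))
      + L * Min {dist (g x) (T x), dist (f y) (S y), dist (f y) (T x), dist (g x) (S y)}"
    if "x \<in> A" and "y \<in> A" for x y
  proof -
    have "{dist (g x) (T x), dist (f y) (S y), dist (f y) (T x), dist (g x) (S y)}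
        = {dist (f y) (S y), dist (g x) (T x), dist (g x) (S y), dist (f y) (T x)}"
      by blast
    moreover have "dist (S y) (T x) \<le>
        \<alpha> * dist (f y) (S y) + \<beta> * dist (g x) (T x) + \<gamma> * dist (f y) (g x)
        + \<delta> * (dist (g x) (S y) + dist (f y) (T x))
        + L * Min {dist (f y) (S y), dist (g x) (T x), dist (g x) (S y), dist (f y) (T x)}"
      using assms that by (simp add: almost_contractive_def)
    ultimately show ?thesis
      by (simp only: dist_commute[of "T x" "S y"] dist_commute[of "g x" "f y"] add_ac)
  qed
  then show ?thesis
    using assms by (simp add: almost_contractive_def)
qed

lemma nonneg_eq_0_if_le_mult:
  fixes r d :: real
  assumes "d \<le> r * d" and "r < 1" and "0 \<le> d"
  shows "d = 0"
proof (rule ccontr)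
  assume "d \<noteq> 0"
  with assms(2,3) have "r * d < 1 * d"
    by (intro mult_strict_right_mono) simp_all
  with assms(1) show False by simp
qed

text \<open>
  At coincidence points the terms with \<open>\<alpha>\<close>, \<open>\<beta>\<close> and \<open>L\<close> vanish and all other distances equal
  that of the two values, which is therefore at most \<open>\<gamma> + 2 * \<delta> < 1\<close> times itself.
\<close>

lemma coincidence_values_agree:
  assumes contr: "almost_contractive \<alpha> \<beta> \<gamma> \<delta> L A f g S T" and "x \<in> A" and "y \<in> A"
    and "S x = f x" and "T y = g y"
  shows "S x = T y"
proof -
  have "dist (S x) (T y) \<le> (\<gamma> + 2 * \<delta>) * dist (S x) (T y)"
    using almost_contractive_bound[OF contr assms(2,3), of 0] assms(4,5)
    by (simp add: dist_commute algebra_simps)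
  moreover have "\<gamma> + 2 * \<delta> < 1"
    using contr by (simp add: almost_contractive_def)
  ultimately have "dist (S x) (T y) = 0"
    by (rule nonneg_eq_0_if_le_mult) simp
  then show ?thesis by simp
qed

section \<open>Alternating orbits of two self-maps\<close>

text \<open>
  Taking \<open>v = F u\<close> makes the cross distance from \<open>v\<close> to \<open>F u\<close> vanish, and with it the term
  with \<open>L\<close>. The other cross distance is split by the triangle inequality, which gives the
  ratio.
\<close>

lemma alternate_step:
  assumes contr: "almost_contractive \<alpha> \<beta> \<gamma> \<delta> L C id id F G" and "u \<in> C" and "F u \<in> C"
  shows "dist (F u) (G (F u)) \<le> (\<alpha> + \<gamma> + \<delta>) / (1 - \<beta> - \<delta>) * dist u (F u)"
proof -
  let ?p = "dist u (F u)" and ?q = "dist (F u) (G (F u))"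
  have coeffs: "0 \<le> \<alpha>" "0 \<le> \<gamma>" "0 \<le> \<delta>" "\<alpha> + \<beta> + \<gamma> + 2 * \<delta> < 1"
    using contr by (simp_all add: almost_contractive_def)
  have "?q \<le> \<alpha> * ?p + \<beta> * ?q + \<gamma> * ?p + \<delta> * dist u (G (F u))"
    using almost_contractive_bound[OF contr assms(2,3), of 0] by simp
  also have "\<delta> * dist u (G (F u)) \<le> \<delta> * (?p + ?q)"
    using coeffs by (intro mult_left_mono dist_triangle) simp
  finally have "(1 - \<beta> - \<delta>) * ?q \<le> (\<alpha> + \<gamma> + \<delta>) * ?p"
    by (simp add: algebra_simps)
  moreover have "0 < 1 - \<beta> - \<delta>"
    using coeffs by linarith
  ultimately show ?thesis
    by (simp add: field_simps)
qed

primrec alternating_orbit :: "('a \<Rightarrow> 'a) \<Rightarrow> ('a \<Rightarrow> 'a) \<Rightarrow> 'a \<Rightarrow> nat \<Rightarrow> 'a" where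
  "alternating_orbit F G u 0 = u"
| "alternating_orbit F G u (Suc n) =
    (if even n then F else G) (alternating_orbit F G u n)"

lemma alternating_orbit_in:
  assumes "F ` C \<subseteq> C" and "G ` C \<subseteq> C" and "u \<in> C"
  shows "alternating_orbit F G u n \<in> C"
  using assms by (induction n) auto

lemma Cauchy_if_geometric_steps:
  fixes X :: "nat \<Rightarrow> 'a::metric_space"
  assumes step: "\<And>n. dist (X (Suc n)) (X (Suc (Suc n))) \<le> r * dist (X n) (X (Suc n))"
    and "0 \<le> r" and "r < 1"
  shows "Cauchy X"
proof -
  let ?d = "dist (X 0) (X (Suc 0))"
  have geometric: "dist (X n) (X (Suc n)) \<le> r ^ n * ?d" for n
  proof (induction n)
    case (Suc n)
    have "dist (X (Suc n)) (X (Suc (Suc n))) \<le> r * dist (X n) (X (Suc n))"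
      by (rule step)
    also have "\<dots> \<le> r * (r ^ n * ?d)"
      using Suc.IH \<open>0 \<le> r\<close> by (intro mult_left_mono)
    finally show ?case by (simp add: mult.assoc)
  qed simp
  \<comment> \<open>The sharper partial sum keeps the induction on \<open>k\<close> going; the last step drops
    its negative part.\<close>
  have partial: "(1 - r) * dist (X n) (X (n + k)) \<le> (r ^ n - r ^ (n + k)) * ?d" for n k
  proof (induction k)
    case (Suc k)
    have "(1 - r) * dist (X n) (X (n + Suc k))
        \<le> (1 - r) * (dist (X n) (X (n + k)) + r ^ (n + k) * ?d)"
      using \<open>r < 1\<close> geometric[of "n + k"] dist_triangle[of "X n" "X (n + Suc k)" "X (n + k)"]
      by (intro mult_left_mono) simp_all
    also have "\<dots> \<le> (r ^ n - r ^ (n + k)) * ?d + (1 - r) * (r ^ (n + k) * ?d)"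
      using Suc.IH by (simp add: distrib_left)
    also have "\<dots> = (r ^ n - r ^ (n + Suc k)) * ?d"
      by (simp add: algebra_simps)
    finally show ?case .
  qed simp
  have tail: "dist (X n) (X (n + k)) \<le> r ^ n * (?d / (1 - r))" for n k
  proof -
    have "(r ^ n - r ^ (n + k)) * ?d \<le> r ^ n * ?d"
      using \<open>0 \<le> r\<close> by (intro mult_right_mono) simp_all
    with partial[of n k] have "(1 - r) * dist (X n) (X (n + k)) \<le> r ^ n * ?d"
      by linarith
    with \<open>r < 1\<close> show ?thesis by (simp add: field_simps)
  qed
  have "(\<lambda>n. r ^ n * (?d / (1 - r))) \<longlonglongrightarrow> 0"
    using \<open>0 \<le> r\<close> \<open>r < 1\<close> by (intro tendsto_mult_left_zero LIMSEQ_realpow_zero)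
  show ?thesis
  proof (rule CauchyI')
    fix e :: real
    assume "0 < e"
    with \<open>(\<lambda>n. r ^ n * (?d / (1 - r))) \<longlonglongrightarrow> 0\<close>
    have "\<forall>\<^sub>F n in sequentially. r ^ n * (?d / (1 - r)) < e"
      by (rule order_tendstoD(2))
    then obtain N where N: "r ^ n * (?d / (1 - r)) < e" if "N \<le> n" for n
      unfolding eventually_sequentially by blast
    have "dist (X m) (X n) < e" if "N \<le> m" and "m < n" for m n
      using tail[of m "n - m"] N[OF that(1)] that(2) by simp
    then show "\<exists>M. \<forall>m\<ge>M. \<forall>n>m. dist (X m) (X n) < e" by blast
  qed
qed

text \<open>
  Steps from \<open>F\<close> to \<open>G\<close> and steps from \<open>G\<close> to \<open>F\<close> shrink by ratios that differ in the roles
  of \<open>\<alpha>\<close> and \<open>\<beta>\<close>; the larger of the two works for all of them.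
\<close>

lemma alternating_orbit_Cauchy:
  assumes contr: "almost_contractive \<alpha> \<beta> \<gamma> \<delta> L C id id F G"
    and "F ` C \<subseteq> C" and "G ` C \<subseteq> C" and "u \<in> C"
  shows "Cauchy (alternating_orbit F G u)"
proof -
  let ?X = "alternating_orbit F G u"
  let ?r = "(\<alpha> + \<gamma> + \<delta>) / (1 - \<beta> - \<delta>)" and ?s = "(\<beta> + \<gamma> + \<delta>) / (1 - \<alpha> - \<delta>)"
  have coeffs: "0 \<le> \<alpha>" "0 \<le> \<beta>" "0 \<le> \<gamma>" "0 \<le> \<delta>" "\<alpha> + \<beta> + \<gamma> + 2 * \<delta> < 1"
    using contr by (simp_all add: almost_contractive_def)
  have inC: "?X n \<in> C" for n
    by (rule alternating_orbit_in[OF assms(2-4)])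
  have "dist (?X (Suc n)) (?X (Suc (Suc n))) \<le> max ?r ?s * dist (?X n) (?X (Suc n))" for n
  proof (cases "even n")
    case True
    then have "dist (?X (Suc n)) (?X (Suc (Suc n))) \<le> ?r * dist (?X n) (?X (Suc n))"
      using alternate_step[OF contr inC[of n]] inC[of "Suc n"] by simp
    also have "\<dots> \<le> max ?r ?s * dist (?X n) (?X (Suc n))"
      by (intro mult_right_mono) simp_all
    finally show ?thesis .
  next
    case False
    then have "dist (?X (Suc n)) (?X (Suc (Suc n))) \<le> ?s * dist (?X n) (?X (Suc n))"
      using alternate_step[OF almost_contractive_swap[OF contr] inC[of n]] inC[of "Suc n"]
      by simp
    also have "\<dots> \<le> max ?r ?s * dist (?X n) (?X (Suc n))"
      by (intro mult_right_mono) simp_all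
    finally show ?thesis .
  qed
  moreover have "0 \<le> max ?r ?s"
    using coeffs by (intro max.coboundedI1 divide_nonneg_nonneg) linarith+
  moreover have "max ?r ?s < 1"
    using coeffs by simp
  ultimately show ?thesis
    by (rule Cauchy_if_geometric_steps)
qed

section \<open>Common fixed points\<close>

text \<open>
  Along the approximating sequence the distance from \<open>v n\<close> to \<open>G (v n)\<close> tends to zero, which
  removes both the term with \<open>\<beta>\<close> and the term with \<open>L\<close> in the limit, and so does the distance
  from \<open>u\<close> to \<open>v n\<close>. What is left bounds the distance from \<open>u\<close> to \<open>F u\<close> by \<open>\<alpha> + \<delta> < 1\<close>
  times itself.
\<close>

lemma limit_is_fixed_point:
  assumes contr: "almost_contractive \<alpha> \<beta> \<gamma> \<delta> L C id id F G"
    and "u \<in> C" and "\<And>n. v n \<in> C" and lim: "v \<longlonglongrightarrow> u" "(\<lambda>n. G (v n)) \<longlonglongrightarrow> u"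
  shows "F u = u"
proof -
  have "dist (F u) (G (v n)) \<le> \<alpha> * dist u (F u) + \<beta> * dist (v n) (G (v n))
      + \<gamma> * dist u (v n) + \<delta> * (dist (v n) (F u) + dist u (G (v n)))
      + L * dist (v n) (G (v n))" for n
    using almost_contractive_bound[OF contr \<open>u \<in> C\<close> assms(3), of "dist (v n) (G (v n))" n]
    by simp
  moreover have "(\<lambda>n. \<alpha> * dist u (F u) + \<beta> * dist (v n) (G (v n))
      + \<gamma> * dist u (v n) + \<delta> * (dist (v n) (F u) + dist u (G (v n)))
      + L * dist (v n) (G (v n)))
    \<longlonglongrightarrow> \<alpha> * dist u (F u) + \<beta> * dist u u + \<gamma> * dist u u
      + \<delta> * (dist u (F u) + dist u u) + L * dist u u"
    by (intro tendsto_intros lim)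
  moreover have "(\<lambda>n. dist (F u) (G (v n))) \<longlonglongrightarrow> dist (F u) u"
    by (intro tendsto_intros lim)
  ultimately have "dist (F u) u \<le> \<alpha> * dist u (F u) + \<beta> * dist u u + \<gamma> * dist u u
      + \<delta> * (dist u (F u) + dist u u) + L * dist u u"
    by (intro LIMSEQ_le) auto
  then have "dist (F u) u \<le> (\<alpha> + \<delta>) * dist (F u) u"
    by (simp add: dist_commute algebra_simps)
  moreover have "\<alpha> + \<delta> < 1"
    using contr by (simp add: almost_contractive_def)
  ultimately have "dist (F u) u = 0"
    by (rule nonneg_eq_0_if_le_mult) simp
  then show ?thesis by simp
qed

text \<open>
  The odd terms of the orbit are points to which \<open>G\<close> is applied, so the limit is fixed by \<open>F\<close>.
  With \<open>F u = u\<close> the constant sequence \<open>u\<close> approximates \<open>u\<close> for the swapped pair, and the same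
  lemma yields \<open>G u = u\<close>.
\<close>

lemma common_fixed_point:
  assumes contr: "almost_contractive \<alpha> \<beta> \<gamma> \<delta> L C id id F G"
    and "F ` C \<subseteq> C" and "G ` C \<subseteq> C" and "complete C" and "C \<noteq> {}"
  obtains u where "u \<in> C" and "F u = u" and "G u = u"
proof -
  obtain c where "c \<in> C"
    using \<open>C \<noteq> {}\<close> by blast
  let ?X = "alternating_orbit F G c"
  have inC: "?X n \<in> C" for n
    by (rule alternating_orbit_in[OF assms(2,3) \<open>c \<in> C\<close>])
  have "Cauchy ?X"
    by (rule alternating_orbit_Cauchy[OF contr assms(2,3) \<open>c \<in> C\<close>])
  with \<open>complete C\<close> inC obtain u where "u \<in> C" and lim: "?X \<longlonglongrightarrow> u"
    by (meson completeE)
  have odd: "(\<lambda>n. ?X (2 * n + 1)) \<longlonglongrightarrow> u"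
    using LIMSEQ_subseq_LIMSEQ[OF lim, of "\<lambda>n. 2 * n + 1"]
    by (simp add: strict_mono_def o_def)
  have "(\<lambda>n. ?X (2 * n + 2)) \<longlonglongrightarrow> u"
    using LIMSEQ_subseq_LIMSEQ[OF lim, of "\<lambda>n. 2 * n + 2"]
    by (simp add: strict_mono_def o_def)
  then have even: "(\<lambda>n. G (?X (2 * n + 1))) \<longlonglongrightarrow> u"
    by simp
  have "F u = u"
    by (rule limit_is_fixed_point[OF contr \<open>u \<in> C\<close> inC odd even])
  moreover have "G u = u"
    using \<open>F u = u\<close> \<open>u \<in> C\<close>
    by (intro limit_is_fixed_point[OF almost_contractive_swap[OF contr], of u "\<lambda>_. u"]) simp_all
  ultimately show thesis
    using that \<open>u \<in> C\<close> by blast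
qed

theorem theorem3:
  fixes S T f g :: "'a::metric_space \<Rightarrow> 'a"
    and \<alpha> \<beta> \<gamma> \<delta> L :: real
  assumes "range S \<subseteq> range f"
    and "range T \<subseteq> range f"
    and "range f = range g"
    and "\<alpha> \<in> {0..<1}" and "\<beta> \<in> {0..<1}" and "\<gamma> \<in> {0..<1}" and "\<delta> \<in> {0..<1}"
    and "\<alpha> + \<beta> + \<gamma> + 2 * \<delta> < 1"
    and "L \<ge> 0"
    and "\<And>x y. dist (S x) (T y) \<le>
          \<alpha> * dist (f x) (S x) + \<beta> * dist (g y) (T y) + \<gamma> * dist (f x) (g y)
          + \<delta> * (dist (g y) (S x) + dist (f x) (T y))
          + L * Min {dist (f x) (S x), dist (g y) (T y), dist (g y) (S x), dist (f x) (T y)}"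
    and "weakly_compatible S f"
    and "weakly_compatible T g"
    and "complete (range f)"
  shows "\<exists>!z. S z = z \<and> T z = z \<and> f z = z \<and> g z = z"
proof -
  have contr: "almost_contractive \<alpha> \<beta> \<gamma> \<delta> L UNIV f g S T"
    using assms(4-10) by (simp add: almost_contractive_def)
  let ?C = "range f" and ?F = "S \<circ> inv f" and ?G = "T \<circ> inv g"
  have right_inverse: "f (inv f u) = u" "g (inv g u) = u" if "u \<in> ?C" for u
    using that assms(3) by (simp_all add: f_inv_into_f)
  have "almost_contractive \<alpha> \<beta> \<gamma> \<delta> L ?C id id ?F ?G"
    unfolding almost_contractive_def
  proof (intro conjI ballI)
    fix u v
    assume "u \<in> ?C" and "v \<in> ?C"
    then show "dist (?F u) (?G v) \<le>
        \<alpha> * dist (id u) (?F u) + \<beta> * dist (id v) (?G v) + \<gamma> * dist (id u) (id v)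
        + \<delta> * (dist (id v) (?F u) + dist (id u) (?G v))
        + L * Min {dist (id u) (?F u), dist (id v) (?G v), dist (id v) (?F u), dist (id u) (?G v)}"
      using assms(10)[of "inv f u" "inv g v"] by (simp only: right_inverse o_apply id_apply)
  qed (use assms(4-9) in simp_all)
  moreover have "?F ` ?C \<subseteq> ?C" and "?G ` ?C \<subseteq> ?C"
    using assms(1,2) by auto
  ultimately obtain u where "u \<in> ?C" and fixed: "?F u = u" "?G u = u"
    using assms(13) by (rule common_fixed_point) simp_all
  define p q where "p = inv f u" and "q = inv g u"
  have p: "S p = u" "f p = u" and q: "T q = u" "g q = u"
    using fixed right_inverse[OF \<open>u \<in> ?C\<close>] by (simp_all add: p_def q_def)
  have Sf: "S u = f u"
    using assms(11) p by (metis weakly_compatible_def)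
  have Tg: "T u = g u"
    using assms(12) q by (metis weakly_compatible_def)
  have "S u = T q"
    using Sf q by (intro coincidence_values_agree[OF contr]) simp_all
  moreover have "S p = T u"
    using Tg p by (intro coincidence_values_agree[OF contr]) simp_all
  ultimately have "S u = u \<and> T u = u \<and> f u = u \<and> g u = u"
    using p q Sf Tg by simp
  moreover have "z = u" if "S z = z \<and> T z = z \<and> f z = z \<and> g z = z" for z
  proof -
    have "S z = T u"
      using that Tg by (intro coincidence_values_agree[OF contr]) simp_all
    with that \<open>S u = u \<and> T u = u \<and> f u = u \<and> g u = u\<close> show ?thesis by simp
  qed
  ultimately show ?thesis by blast
qed

end
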